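(* Assume $1<p_i<+\infty$ for $i=1,\dots,m$. Let $a,b,c\in\mathbb{R}^d$ be consecutive breaking points of a geodesic path such that $a\in P_i\setminus F_{ij}$, $b\in F_{ij}$ and $c\in P_j\setminus F_{ij}$ (where $i,j$ are the consecutive cells of the path whose gate point in $F_{ij}$ is $b$). Let $\mathcal{F}_b$ be the face of $F_{ij}$ such that $b$ lies in the relative interior of $\mathcal{F}_b$. Then, for each nonzero vector $v\in L(\mathrm{aff}(\mathcal{F}_b))$, the gate point $b$ satisfies $$\omega_i\|v\|_{p_i}\cos\varphi_{p_i^\circ}\big((b-a)^\circ,v\big)=\omega_j\|v\|_{p_j}\cos\varphi_{p_j^\circ}\big((c-b)^\circ,v\big),$$ or equivalently, $$\omega_i\|v\|_{p_i}\cos\varphi_{p_i}\big(v,(b-a)^\circ\big)=\omega_j\|v\|_{p_j}\cos\varphi_{p_j}\big(v,(c-b)^\circ\big),$$ where $(b-a)^\circ$ is the polar vector of $b-a$ in $(\mathbb{R}^d,\|\cdot\|_{p_i})$ and $(c-b)^\circ$ is the polar vector of $c-b$ in $(\mathbb{R}^d,\|\cdot\|_{p_j})$.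
   Context: Setting. $P_1,\dots,P_m\subseteq\mathbb{R}^d$ are the cells of a polyhedral subdivision, with $\mathrm{int}(P_i)\cap\mathrm{int}(P_j)=\emptyset$ for $i\ne j$; the cells are assumed to be polytopes (bounded polyhedra). Cell $P_i$ is endowed with the $\ell_{p_i}$-norm $\|\cdot\|_{p_i}$ and a weight $\omega_i>0$. The undirected graph $G=(V,E)$ has $V=\{1,\dots,m\}$ and $\{i,j\}\in E$ ($i\neq j$) iff $P_i$ and $P_j$ have a common (nonempty) face; for $\{i,j\}\in E$, $F_{ij}=F_{ji}=P_i\cap P_j$ is their maximal common face. Points $x_s\in P_s$, $x_t\in P_t$, $s\ne t$, are given, and $\Gamma$ is the set of simple paths $(s,i_1,\dots,i_k,t)$ from $s$ to $t$ in $G$ (all vertices distinct). Geodesic path. Fix $\gamma=(i_0,i_1,\dots,i_k,i_{k+1})\in\Gamma$ with $i_0=s$, $i_{k+1}=t$. Let the gate points $y_{i_r i_{r+1}}\in F_{i_r i_{r+1}}$, $r=0,\dots,k$, minimize, over $F_{i_0i_1}\times\dots\times F_{i_ki_{k+1}}$, $$\omega_s\|y_{s i_1}-x_s\|_{p_s}+\sum_{r=1}^{k}\omega_{i_r}\|y_{i_r i_{r+1}}-y_{i_{r-1}i_r}\|_{p_{i_r}}+\omega_t\|x_t-y_{i_k t}\|_{p_t}.$$ The piecewise linear path through $x_s,y_{si_1},y_{i_1i_2},\dots,y_{i_kt},x_t$ (in this order) is called a geodesic path between $x_s$ and $x_t$, and these points are its breaking points. Notation. $\mathrm{aff}(S)$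 is the affine hull of $S$; for an affine set $S$, $L(S)=\{x-x':x,x'\in S\}$. For $p\in(1,+\infty)$, $p^\circ=p/(p-1)$ (so $(p^\circ)^\circ=p$). The polar vector of a nonzero vector $v$ in $(\mathbb{R}^d,\|\cdot\|_p)$ is $v^\circ=(v_1^\circ,\dots,v_d^\circ)^T$ with $v_k^\circ=\left(\frac{|v_k|}{\|v\|_p}\right)^{p-1}\mathrm{sign}(v_k)\,\|v\|_p$; the polar vector of $0$ is $0$. For $p\in(1,+\infty)$ and nonzero $v,v'\in\mathbb{R}^d$, the $\ell_p$-angle $\varphi_p(v,v')\in[0,\pi]$ is defined by $\cos\varphi_p(v,v')=\frac{v^Tv'}{\|v\|_p\|v'\|_{p^\circ}}$. *)

theory Defs
  imports "HOL-Analysis.Analysis"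
begin

definition lp_norm :: "real \<Rightarrow> real ^ 'd \<Rightarrow> real" where
  "lp_norm p x = (\<Sum>k\<in>UNIV. \<bar>x $ k\<bar> powr p) powr (1 / p)"

definition conj_exponent :: "real \<Rightarrow> real" where
  "conj_exponent p = p / (p - 1)"

definition polar :: "real \<Rightarrow> real ^ 'd \<Rightarrow> real ^ 'd" where
  "polar p v =
    (if v = 0 then 0
     else (\<chi> k. (\<bar>v $ k\<bar> / lp_norm p v) powr (p - 1) * sgn (v $ k) * lp_norm p v))"

text \<open>By Hoelder's inequality the quotient lies in \<open>{-1..1}\<close> for \<open>p > 1\<close> and nonzero
  \<open>v\<close>, \<open>w\<close>, so that \<open>arccos\<close> yields the angle in \<open>{0..pi}\<close> with this cosine. The two vectors
  play asymmetric roles: the first is measured in \<open>p\<close>, the second in the conjugate exponent.\<close>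

definition lp_angle :: "real \<Rightarrow> real ^ 'd \<Rightarrow> real ^ 'd \<Rightarrow> real" where
  "lp_angle p v w = arccos (v \<bullet> w / (lp_norm p v * lp_norm (conj_exponent p) w))"

definition direction_space :: "'a::ab_group_add set \<Rightarrow> 'a set" where
  "direction_space S = {x - x' | x x'. x \<in> S \<and> x' \<in> S}"

text \<open>The cells are \<open>P 1, \<dots>, P m\<close>. Since \<open>{}\<close> is a \<open>face_of\<close> every set, disjoint cells satisfy
  the face-to-face condition. Cells need not be full-dimensional or cover the space.\<close>

definition polytopal_subdivision :: "nat \<Rightarrow> (nat \<Rightarrow> (real ^ 'd) set) \<Rightarrow> bool" where
  "polytopal_subdivision m P \<longleftrightarrow>
    (\<forall>i\<in>{1..m}. polytope (P i)) \<and>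
    (\<forall>i\<in>{1..m}. \<forall>j\<in>{1..m}. i \<noteq> j \<longrightarrow>
      interior (P i) \<inter> interior (P j) = {} \<and>
      P i \<inter> P j face_of P i \<and> P i \<inter> P j face_of P j)"

definition cell_edges :: "nat \<Rightarrow> (nat \<Rightarrow> (real ^ 'd) set) \<Rightarrow> nat set set" where
  "cell_edges m P =
    {{i, j} | i j. i \<in> {1..m} \<and> j \<in> {1..m} \<and> i \<noteq> j \<and>
      (\<exists>F. F \<noteq> {} \<and> F face_of P i \<and> F face_of P j)}"

definition common_face :: "(nat \<Rightarrow> (real ^ 'd) set) \<Rightarrow> nat \<Rightarrow> nat \<Rightarrow> (real ^ 'd) set" where
  "common_face P i j = P i \<inter> P j"

definition simple_cell_paths ::
  "nat \<Rightarrow> (nat \<Rightarrow> (real ^ 'd) set) \<Rightarrow> nat \<Rightarrow> nat \<Rightarrow> nat list set" where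
  "simple_cell_paths m P s t =
    {\<gamma>. \<gamma> \<noteq> [] \<and> hd \<gamma> = s \<and> last \<gamma> = t \<and> set \<gamma> \<subseteq> {1..m} \<and> distinct \<gamma> \<and>
      successively (\<lambda>i j. {i, j} \<in> cell_edges m P) \<gamma>}"

text \<open>A path \<open>\<gamma>\<close> with at least two cells is \<open>[i\<^sub>0, \<dots>, i\<^bsub>k+1\<^esub>]\<close> with \<open>k = length \<gamma> - 2\<close>. Its gate
  points are indexed by \<open>{0..k}\<close>: \<open>y r\<close> is the gate point between \<open>\<gamma> ! r\<close> and \<open>\<gamma> ! (r + 1)\<close>.\<close>

definition gate_cost ::
  "(nat \<Rightarrow> real) \<Rightarrow> (nat \<Rightarrow> real) \<Rightarrow> real ^ 'd \<Rightarrow> real ^ 'd \<Rightarrow> nat list \<Rightarrow>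
    (nat \<Rightarrow> real ^ 'd) \<Rightarrow> real" where
  "gate_cost \<omega> p x\<^sub>s x\<^sub>t \<gamma> y =
    (let k = length \<gamma> - 2; s = hd \<gamma>; t = last \<gamma> in
      \<omega> s * lp_norm (p s) (y 0 - x\<^sub>s) +
      (\<Sum>r = 1..k. \<omega> (\<gamma> ! r) * lp_norm (p (\<gamma> ! r)) (y r - y (r - 1))) +
      \<omega> t * lp_norm (p t) (x\<^sub>t - y k))"

definition geodesic_gates ::
  "(nat \<Rightarrow> (real ^ 'd) set) \<Rightarrow> (nat \<Rightarrow> real) \<Rightarrow> (nat \<Rightarrow> real) \<Rightarrow> real ^ 'd \<Rightarrow> real ^ 'd \<Rightarrow>
    nat list \<Rightarrow> (nat \<Rightarrow> real ^ 'd) \<Rightarrow> bool" where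
  "geodesic_gates P \<omega> p x\<^sub>s x\<^sub>t \<gamma> y \<longleftrightarrow>
    is_arg_min (gate_cost \<omega> p x\<^sub>s x\<^sub>t \<gamma>)
      (\<lambda>z. z \<in> (\<Pi>\<^sub>E r\<in>{0..length \<gamma> - 2}. common_face P (\<gamma> ! r) (\<gamma> ! (r + 1)))) y"

definition breaking_points ::
  "real ^ 'd \<Rightarrow> real ^ 'd \<Rightarrow> nat list \<Rightarrow> (nat \<Rightarrow> real ^ 'd) \<Rightarrow> (real ^ 'd) list" where
  "breaking_points x\<^sub>s x\<^sub>t \<gamma> y = x\<^sub>s # map y [0..<length \<gamma> - 1] @ [x\<^sub>t]"

end

theory Submission
  imports Defs
begin

text \<open>The gate point \<open>b\<close> only enters two terms of the cost, those of the segments from \<open>a\<close> and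
  to \<open>c\<close>. Since \<open>b\<close> is a relative interior point of its face, it may be moved to \<open>b + h *\<^sub>R v\<close>
  for all small \<open>h\<close> of either sign, so the derivative of the two terms in \<open>h\<close> vanishes at \<open>0\<close>.
  Away from the origin the \<open>\<ell>\<^sub>p\<close>-norm is differentiable and its derivative at \<open>u\<close> in direction
  \<open>v\<close> is \<open>u\<degree> \<bullet> v / \<parallel>u\<parallel>\<^sub>p\<close>; as \<open>\<parallel>u\<degree>\<parallel> = \<parallel>u\<parallel>\<^sub>p\<close> in the conjugate norm, this is \<open>\<parallel>v\<parallel>\<^sub>p\<close> times the
  cosine of the angle.\<close>

section \<open>Elementary facts on the norm, the polar vector and conjugate exponents\<close>

lemma lp_norm_nonneg: "0 \<le> lp_norm p v"
  by (simp add: lp_norm_def)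

lemma sum_abs_powr_pos:
  fixes v :: "real ^ 'd"
  assumes "v \<noteq> 0"
  shows "0 < (\<Sum>k\<in>UNIV. \<bar>v $ k\<bar> powr p)"
proof -
  obtain k where k: "v $ k \<noteq> 0"
    using assms by (auto simp: vec_eq_iff)
  show ?thesis
    by (rule sum_pos2[of _ k]) (use k in auto)
qed

lemma lp_norm_pos: "v \<noteq> 0 \<Longrightarrow> 0 < lp_norm p v"
  using sum_abs_powr_pos[of v p] by (simp add: lp_norm_def)

lemma lp_norm_powr:
  assumes "0 < p"
  shows "lp_norm p v powr p = (\<Sum>k\<in>UNIV. \<bar>v $ k\<bar> powr p)"
  using assms by (simp add: lp_norm_def powr_powr sum_nonneg)

lemma lp_norm_uminus: "lp_norm p (- v) = lp_norm p v"
  by (simp add: lp_norm_def)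

lemma polar_uminus: "polar p (- v) = - polar p v"
  by (simp add: polar_def lp_norm_uminus vec_eq_iff sgn_minus)

lemma conj_exponent_gt_1: "1 < p \<Longrightarrow> 1 < conj_exponent p"
  by (simp add: conj_exponent_def)

lemma conj_exponent_conj_exponent: "1 < p \<Longrightarrow> conj_exponent (conj_exponent p) = p"
  by (simp add: conj_exponent_def field_simps)

lemma conj_exponent_inverse_sum: "1 < p \<Longrightarrow> 1 / p + 1 / conj_exponent p = 1"
  by (simp add: conj_exponent_def field_simps)

section \<open>Hoelder's inequality, angles and the norm of a polar vector\<close>

lemma Hoelder_inequality_vec:
  fixes v w :: "real ^ 'd"
  assumes p: "1 < p"
  shows "\<bar>v \<bullet> w\<bar> \<le> lp_norm p v * lp_norm (conj_exponent p) w"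
proof (cases "v = 0 \<or> w = 0")
  case True
  then show ?thesis
    by (auto simp: lp_norm_nonneg)
next
  case False
  define q where "q = conj_exponent p"
  define A where "A = lp_norm p v"
  define B where "B = lp_norm q w"
  have q: "1 < q" and pq: "1 / p + 1 / q = 1"
    using p conj_exponent_gt_1 conj_exponent_inverse_sum by (auto simp: q_def)
  have pos: "0 < A" "0 < B"
    using False lp_norm_pos by (auto simp: A_def B_def)
  have sums: "(\<Sum>k\<in>UNIV. \<bar>v $ k\<bar> powr p) = A powr p" "(\<Sum>k\<in>UNIV. \<bar>w $ k\<bar> powr q) = B powr q"
    using p q lp_norm_powr[of p v] lp_norm_powr[of q w] by (auto simp: A_def B_def)
  have "\<bar>v \<bullet> w\<bar> \<le> (\<Sum>k\<in>UNIV. \<bar>v $ k\<bar> * \<bar>w $ k\<bar>)"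
    unfolding inner_vec_def by (rule order_trans[OF sum_abs]) (simp add: abs_mult)
  \<comment> \<open>Both vectors are scaled to norm one, so that Young's inequality applied entry by
    entry sums to exactly \<open>1 / p + 1 / q = 1\<close>.\<close>
  also have "\<dots> = A * B * (\<Sum>k\<in>UNIV. (\<bar>v $ k\<bar> / A) * (\<bar>w $ k\<bar> / B))"
    using pos by (simp add: sum_distrib_left field_simps)
  also have "\<dots> \<le> A * B * (\<Sum>k\<in>UNIV. (\<bar>v $ k\<bar> / A) powr p / p + (\<bar>w $ k\<bar> / B) powr q / q)"
    using p q pq pos by (intro mult_left_mono sum_mono Youngs_inequality) auto
  also have "(\<Sum>k\<in>UNIV. (\<bar>v $ k\<bar> / A) powr p / p + (\<bar>w $ k\<bar> / B) powr q / q)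
      = (\<Sum>k\<in>UNIV. \<bar>v $ k\<bar> powr p) / A powr p / p + (\<Sum>k\<in>UNIV. \<bar>w $ k\<bar> powr q) / B powr q / q"
    using pos by (simp add: powr_divide sum.distrib sum_divide_distrib)
  also have "\<dots> = 1"
    using pos pq by (simp add: sums)
  finally show ?thesis
    by (simp add: A_def B_def q_def)
qed

text \<open>Hoelder's inequality puts the quotient inside the range where \<open>cos\<close> undoes
  \<open>arccos\<close>.\<close>

lemma cos_lp_angle:
  fixes v w :: "real ^ 'd"
  assumes "1 < p"
  shows "cos (lp_angle p v w) = v \<bullet> w / (lp_norm p v * lp_norm (conj_exponent p) w)"
proof -
  define D where "D = lp_norm p v * lp_norm (conj_exponent p) w"
  have "\<bar>v \<bullet> w\<bar> \<le> D" "0 \<le> D"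
    using Hoelder_inequality_vec[OF assms, of v w] by (simp_all add: D_def lp_norm_nonneg)
  \<comment> \<open>If \<open>D = 0\<close>, the quotient is 0 because division by zero yields 0;
    zero vectors are thus covered too.\<close>
  then have "\<bar>v \<bullet> w / D\<bar> \<le> 1"
    by (cases "D = 0") auto
  then show ?thesis
    unfolding lp_angle_def D_def by (rule cos_arccos_abs)
qed

text \<open>With \<open>q\<close> the conjugate exponent, \<open>(p - 1) * q = p\<close>, so the
  \<open>q\<close>-th powers of the polar entries are the \<open>p\<close>-th powers of the entries
  of \<open>v\<close> up to one common factor.\<close>

lemma lp_norm_polar:
  fixes v :: "real ^ 'd"
  assumes p: "1 < p"
  shows "lp_norm (conj_exponent p) (polar p v) = lp_norm p v"
proof (cases "v = 0")
  case True
  then show ?thesis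
    by (simp add: polar_def lp_norm_def)
next
  case False
  define q where "q = conj_exponent p"
  define N where "N = lp_norm p v"
  have q: "1 < q"
    using p conj_exponent_gt_1 by (simp add: q_def)
  have pq: "(p - 1) * q = p"
    using p by (simp add: q_def conj_exponent_def)
  have N: "0 < N"
    using False lp_norm_pos by (auto simp: N_def)
  \<comment> \<open>Zero entries are split off because the sign has absolute value 1 only at nonzero
    ones.\<close>
  have "\<bar>polar p v $ k\<bar> powr q = \<bar>v $ k\<bar> powr p * (N powr q / N powr p)" for k
  proof (cases "v $ k = 0")
    case True
    then show ?thesis
      using False p q by (simp add: polar_def)
  next
    case k: False
    then have "\<bar>polar p v $ k\<bar> = (\<bar>v $ k\<bar> / N) powr (p - 1) * N"
      using False N by (simp add: polar_def N_def[symmetric] abs_mult abs_sgn_eq)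
    then have "\<bar>polar p v $ k\<bar> powr q = (\<bar>v $ k\<bar> / N) powr p * N powr q"
      using N by (simp add: powr_mult powr_powr pq)
    then show ?thesis
      using N by (simp add: powr_divide)
  qed
  then have "(\<Sum>k\<in>UNIV. \<bar>polar p v $ k\<bar> powr q) =
      (\<Sum>k\<in>UNIV. \<bar>v $ k\<bar> powr p) * (N powr q / N powr p)"
    by (simp only: sum_distrib_right)
  also have "(\<Sum>k\<in>UNIV. \<bar>v $ k\<bar> powr p) = N powr p"
    using lp_norm_powr[of p v] p by (simp add: N_def)
  also have "N powr p * (N powr q / N powr p) = N powr q"
    using N by simp
  finally have "(\<Sum>k\<in>UNIV. \<bar>polar p v $ k\<bar> powr q) = N powr q" .
  then have "lp_norm q (polar p v) = N"
    using N q by (simp add: lp_norm_def powr_powr)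
  then show ?thesis
    by (simp add: q_def N_def)
qed

section \<open>Differentiability of the norm away from the origin\<close>

text \<open>The point 0 must be included, since a nonzero vector may have zero entries. There
  \<open>1 < p\<close> is decisive: the difference quotient is bounded by
  \<open>\<bar>h\<bar> powr (p - 1)\<close>, which tends to 0.\<close>

lemma has_field_derivative_abs_powr:
  fixes x p :: real
  assumes p: "1 < p"
  shows "((\<lambda>x. \<bar>x\<bar> powr p) has_field_derivative p * \<bar>x\<bar> powr (p - 1) * sgn x) (at x)"
proof (cases "x = 0")
  case True
  have "((\<lambda>h. \<bar>h\<bar> powr (p - 1)) \<longlongrightarrow> \<bar>0::real\<bar> powr (p - 1)) (at (0::real))"
    using p by (intro tendsto_powr') (auto intro!: tendsto_eq_intros)
  then have "((\<lambda>h. \<bar>h\<bar> powr (p - 1)) \<longlongrightarrow> 0) (at (0::real))"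
    using p by simp
  moreover have "\<forall>\<^sub>F h in at (0::real). norm (\<bar>h\<bar> powr p / h) \<le> \<bar>h\<bar> powr (p - 1)"
    by (auto simp: eventually_at_filter powr_diff)
  ultimately have "((\<lambda>h. \<bar>h\<bar> powr p / h) \<longlongrightarrow> 0) (at (0::real))"
    by (rule Lim_null_comparison[rotated])
  then show ?thesis
    using True p by (simp add: DERIV_def)
next
  case False
  then have "(norm has_field_derivative sgn x) (at x)"
    using has_derivative_norm[of x] by (simp add: has_field_derivative_def mult_commute_abs)
  then have "(abs has_field_derivative sgn x) (at x)"
    by (simp add: real_norm_def[abs_def])
  from DERIV_chain2[OF has_real_derivative_powr[of "\<bar>x\<bar>" p] this] show ?thesis
    using False by simp
qed

text \<open>Chain rule for the \<open>p\<close>-th root of the sum of powers. Since \<open>u\<close>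
  is nonzero the sum is positive, and there the root is differentiable.\<close>

lemma lp_norm_has_field_derivative:
  fixes u v :: "real ^ 'd"
  assumes p: "1 < p" and u: "u \<noteq> 0"
  shows "((\<lambda>h. lp_norm p (u + h *\<^sub>R v)) has_field_derivative polar p u \<bullet> v / lp_norm p u) (at 0)"
proof -
  define N where "N = lp_norm p u"
  define S where "S = (\<Sum>k\<in>UNIV. \<bar>u $ k\<bar> powr p)"
  define D where "D = (\<Sum>k\<in>UNIV. \<bar>u $ k\<bar> powr (p - 1) * sgn (u $ k) * v $ k)"
  have N: "0 < N" and S: "0 < S"
    using u lp_norm_pos sum_abs_powr_pos by (auto simp: N_def S_def)
  have "((\<lambda>h. \<bar>(u + h *\<^sub>R v) $ k\<bar> powr p) has_field_derivative
      p * \<bar>u $ k\<bar> powr (p - 1) * sgn (u $ k) * v $ k) (at 0)" for k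
  proof -
    have "((\<lambda>h. u $ k + h * v $ k) has_field_derivative v $ k) (at 0)"
      by (auto intro!: derivative_eq_intros)
    from DERIV_chain2[OF has_field_derivative_abs_powr[OF p] this] show ?thesis
      by simp
  qed
  then have "((\<lambda>h. \<Sum>k\<in>UNIV. \<bar>(u + h *\<^sub>R v) $ k\<bar> powr p) has_field_derivative
      (\<Sum>k\<in>UNIV. p * \<bar>u $ k\<bar> powr (p - 1) * sgn (u $ k) * v $ k)) (at 0)"
    by (intro DERIV_sum)
  moreover have "(\<Sum>k\<in>UNIV. p * \<bar>u $ k\<bar> powr (p - 1) * sgn (u $ k) * v $ k) = p * D"
    by (simp add: D_def sum_distrib_left mult.assoc)
  ultimately have sum_deriv:
    "((\<lambda>h. \<Sum>k\<in>UNIV. \<bar>(u + h *\<^sub>R v) $ k\<bar> powr p) has_field_derivative p * D) (at 0)"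
    by simp
  have "((\<lambda>x. x powr (1 / p)) has_field_derivative 1 / p * S powr (1 / p - 1)) (at S)"
    using has_real_derivative_powr[OF S, of "1 / p"] by simp
  \<comment> \<open>The point \<open>S\<close> is rewritten as the value of the inner sum at
    \<open>h = 0\<close>, as the chain rule requires.\<close>
  then have outer: "((\<lambda>x. x powr (1 / p)) has_field_derivative 1 / p * S powr (1 / p - 1))
      (at (\<Sum>k\<in>UNIV. \<bar>(u + 0 *\<^sub>R v) $ k\<bar> powr p))"
    by (simp add: S_def)
  have "((\<lambda>h. lp_norm p (u + h *\<^sub>R v)) has_field_derivative 1 / p * S powr (1 / p - 1) * (p * D)) (at 0)"
    unfolding lp_norm_def by (rule DERIV_chain2[OF outer sum_deriv])
  moreover have "1 / p * S powr (1 / p - 1) * (p * D) = polar p u \<bullet> v / N"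
  proof -
    have "S = N powr p"
      using p lp_norm_powr[of p u] by (simp add: S_def N_def)
    then have "S powr (1 / p - 1) = N powr (1 - p)"
      using p by (simp add: powr_powr right_diff_distrib)
    then have "1 / p * S powr (1 / p - 1) * (p * D) = N powr (1 - p) * D"
      using p by simp
    \<comment> \<open>Each polar entry is
      \<open>\<bar>u $ k\<bar> powr (p - 1) * sgn (u $ k)\<close> times
      \<open>N powr (1 - p) * N\<close>; the last \<open>N\<close> cancels against the division by
      the norm.\<close>
    moreover have "polar p u \<bullet> v = N * (N powr (1 - p) * D)"
      using u N unfolding polar_def D_def inner_vec_def
      by (simp add: N_def[symmetric] powr_divide powr_diff sum_distrib_left field_simps)
    ultimately show ?thesis
      using N by simp
  qed
  ultimately show ?thesis
    by (simp add: N_def)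
qed

section \<open>Moving a relative interior point in both directions\<close>

lemma rel_interior_perturb:
  fixes S :: "'a::euclidean_space set"
  assumes x: "x \<in> rel_interior S" and v: "v \<in> direction_space (affine hull S)"
  obtains \<delta> where "0 < \<delta>" "\<And>h. \<bar>h\<bar> < \<delta> \<Longrightarrow> x + h *\<^sub>R v \<in> S"
proof -
  obtain e where e: "0 < e" "ball x e \<inter> affine hull S \<subseteq> S" and xS: "x \<in> S"
    using x by (auto simp: mem_rel_interior_ball)
  obtain z z' where z: "z \<in> affine hull S" "z' \<in> affine hull S" "v = z - z'"
    using v by (auto simp: direction_space_def)
  \<comment> \<open>The \<open>+ 1\<close> keeps the denominator positive even for
    \<open>v = 0\<close>.\<close>
  have "x + h *\<^sub>R v \<in> S" if h: "\<bar>h\<bar> < e / (norm v + 1)" for h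
  proof -
    have "x + h *\<^sub>R v \<in> affine hull S"
      using mem_affine_3_minus[OF affine_affine_hull hull_inc[OF xS] z(1,2)] z(3) by simp
    moreover have "norm (h *\<^sub>R v) < e"
    proof -
      have "\<bar>h\<bar> * norm v \<le> \<bar>h\<bar> * (norm v + 1)"
        by (simp add: mult_left_mono)
      also have "\<dots> < e"
        using h by (simp add: pos_less_divide_eq add_nonneg_pos)
      finally show ?thesis
        by simp
    qed
    then have "x + h *\<^sub>R v \<in> ball x e"
      by (simp add: dist_norm)
    ultimately show ?thesis
      using e(2) by auto
  qed
  moreover have "0 < e / (norm v + 1)"
    using e(1) by (simp add: add_nonneg_pos)
  ultimately show thesis
    using that by blast
qed

section \<open>The path cost as a function of a single gate point\<close>

lemma length_breaking_points:
  "\<gamma> \<noteq> [] \<Longrightarrow> length (breaking_points x\<^sub>s x\<^sub>t \<gamma> y) = length \<gamma> + 1"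
  by (cases \<gamma>) (auto simp: breaking_points_def)

lemma breaking_points_nth_Suc:
  "r + 1 < length \<gamma> \<Longrightarrow> breaking_points x\<^sub>s x\<^sub>t \<gamma> y ! Suc r = y r"
  by (simp add: breaking_points_def nth_append less_diff_conv)

lemma breaking_points_last:
  "\<gamma> \<noteq> [] \<Longrightarrow> breaking_points x\<^sub>s x\<^sub>t \<gamma> y ! length \<gamma> = x\<^sub>t"
  by (cases \<gamma>) (auto simp: breaking_points_def nth_append)

lemma breaking_points_fun_upd:
  assumes "r + 1 < length \<gamma>"
  shows "breaking_points x\<^sub>s x\<^sub>t \<gamma> (y(r := z)) = (breaking_points x\<^sub>s x\<^sub>t \<gamma> y)[r + 1 := z]"
proof -
  have "map (y(r := z)) [0..<length \<gamma> - 1] = (map y [0..<length \<gamma> - 1])[r := z]"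
    using assms by (intro nth_equalityI) (auto simp: nth_list_update)
  then show ?thesis
    using assms by (simp add: breaking_points_def list_update_append less_diff_conv)
qed

text \<open>Treating all segments alike removes the special role of the first and last one, so that
  gates next to \<open>x\<^sub>s\<close> or \<open>x\<^sub>t\<close> need no separate case later.
  Segment \<open>l\<close> lies in cell \<open>\<gamma> ! l\<close> and joins the breaking points
  \<open>l\<close> and \<open>Suc l\<close>.\<close>

lemma gate_cost_breaking_points:
  assumes "2 \<le> length \<gamma>"
  shows "gate_cost \<omega> p x\<^sub>s x\<^sub>t \<gamma> y =
    (\<Sum>l<length \<gamma>. \<omega> (\<gamma> ! l) * lp_norm (p (\<gamma> ! l))
      (breaking_points x\<^sub>s x\<^sub>t \<gamma> y ! Suc l - breaking_points x\<^sub>s x\<^sub>t \<gamma> y ! l))"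
proof -
  define k where "k = length \<gamma> - 2"
  have len: "length \<gamma> = Suc (Suc k)" and ne: "\<gamma> \<noteq> []"
    using assms by (auto simp: k_def)
  define B where "B = breaking_points x\<^sub>s x\<^sub>t \<gamma> y"
  define T where "T l = \<omega> (\<gamma> ! l) * lp_norm (p (\<gamma> ! l)) (B ! Suc l - B ! l)" for l
  have B: "B ! 0 = x\<^sub>s" "\<And>l. l \<le> k \<Longrightarrow> B ! Suc l = y l" "B ! Suc (Suc k) = x\<^sub>t"
    using breaking_points_nth_Suc[of _ \<gamma> x\<^sub>s x\<^sub>t y] breaking_points_last[OF ne, of x\<^sub>s x\<^sub>t y] len
    by (auto simp: B_def breaking_points_def)
  have "(\<Sum>l<Suc (Suc k). T l) = T 0 + (\<Sum>l = 1..k. T l) + T (Suc k)"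
    by (simp add: lessThan_Suc_atMost atMost_atLeast0 sum.atLeast_Suc_atMost)
  moreover have "(\<Sum>l = 1..k. T l) =
      (\<Sum>l = 1..k. \<omega> (\<gamma> ! l) * lp_norm (p (\<gamma> ! l)) (y l - y (l - 1)))"
  proof (rule sum.cong)
    fix l assume "l \<in> {1..k}"
    then show "T l = \<omega> (\<gamma> ! l) * lp_norm (p (\<gamma> ! l)) (y l - y (l - 1))"
      \<comment> \<open>Gate \<open>r\<close> sits at position \<open>r + 1\<close> of the list,
        since \<open>x\<^sub>s\<close> occupies position 0; as \<open>1 \<le> l\<close>, position
        \<open>l\<close> holds gate \<open>l - 1\<close>.\<close>
      using B(2)[of l] B(2)[of "l - 1"] by (auto simp: T_def)
  qed simp
  ultimately show ?thesis
    using B ne len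
    by (simp add: gate_cost_def Let_def T_def B_def[symmetric] hd_conv_nth last_conv_nth)
qed

text \<open>Gate \<open>r\<close> is an endpoint of segments \<open>r\<close> and
  \<open>r + 1\<close> only. \<open>K\<close> collects the other segments and is independent of
  \<open>z\<close>.\<close>

lemma gate_cost_fun_upd:
  fixes x\<^sub>s x\<^sub>t :: "real ^ 'd"
  assumes r: "r + 1 < length \<gamma>"
  obtains K where "\<And>z. gate_cost \<omega> p x\<^sub>s x\<^sub>t \<gamma> (y(r := z)) = K +
    \<omega> (\<gamma> ! r) * lp_norm (p (\<gamma> ! r)) (z - breaking_points x\<^sub>s x\<^sub>t \<gamma> y ! r) +
    \<omega> (\<gamma> ! (r + 1)) * lp_norm (p (\<gamma> ! (r + 1))) (breaking_points x\<^sub>s x\<^sub>t \<gamma> y ! (r + 2) - z)"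
proof -
  define B where "B = breaking_points x\<^sub>s x\<^sub>t \<gamma> y"
  define T where "T C l = \<omega> (\<gamma> ! l) * lp_norm (p (\<gamma> ! l)) (C ! Suc l - C ! l :: real ^ 'd)" for C l
  define R where "R = {..<length \<gamma>} - {r, r + 1}"
  have lenB: "length B = length \<gamma> + 1"
    using r by (cases "\<gamma> = []") (auto simp: B_def length_breaking_points)
  have "gate_cost \<omega> p x\<^sub>s x\<^sub>t \<gamma> (y(r := z)) = sum (T B) R +
    \<omega> (\<gamma> ! r) * lp_norm (p (\<gamma> ! r)) (z - B ! r) +
    \<omega> (\<gamma> ! (r + 1)) * lp_norm (p (\<gamma> ! (r + 1))) (B ! (r + 2) - z)" for z
  proof -
    let ?C = "B[r + 1 := z]"
    have "gate_cost \<omega> p x\<^sub>s x\<^sub>t \<gamma> (y(r := z)) = sum (T ?C) {..<length \<gamma>}"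
      using r unfolding T_def B_def breaking_points_fun_upd[OF r, symmetric]
      by (intro gate_cost_breaking_points) simp
    also have "{..<length \<gamma>} = insert r (insert (r + 1) R)"
      using r by (auto simp: R_def)
    also have "sum (T ?C) \<dots> = T ?C r + (T ?C (r + 1) + sum (T ?C) R)"
      by (subst sum.insert; simp add: R_def)+
    \<comment> \<open>For \<open>l\<close> in \<open>R\<close>, neither \<open>l\<close> nor
      \<open>Suc l\<close> is the updated position \<open>r + 1\<close>.\<close>
    also have "sum (T ?C) R = sum (T B) R"
      by (intro sum.cong) (auto simp: T_def R_def)
    also have "T ?C r = \<omega> (\<gamma> ! r) * lp_norm (p (\<gamma> ! r)) (z - B ! r)"
      using r lenB by (simp add: T_def)
    also have "T ?C (r + 1) = \<omega> (\<gamma> ! (r + 1)) * lp_norm (p (\<gamma> ! (r + 1))) (B ! (r + 2) - z)"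
      using r lenB by (simp add: T_def)
    finally show ?thesis
      by (simp only: add_ac)
  qed
  then show thesis
    using that by (simp add: B_def)
qed

section \<open>The angle condition at a gate point\<close>

text \<open>Conjugating twice gives back \<open>p\<close>, so in both orders of the arguments
  \<open>v\<close> is measured in \<open>p\<close> and the polar vector in the conjugate exponent.
  Hence both forms of the claim reduce to one quotient.\<close>

lemma cos_lp_angle_polar:
  fixes u v :: "real ^ 'd"
  assumes p: "1 < p" and v: "v \<noteq> 0"
  shows "lp_norm p v * cos (lp_angle (conj_exponent p) (polar p u) v) = polar p u \<bullet> v / lp_norm p u"
    and "lp_norm p v * cos (lp_angle p v (polar p u)) = polar p u \<bullet> v / lp_norm p u"
  using p lp_norm_pos[OF v, of p]
  by (simp_all add: cos_lp_angle conj_exponent_gt_1 conj_exponent_conj_exponent lp_norm_polar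
      inner_commute)

theorem corollary11:
  fixes P :: "nat \<Rightarrow> (real ^ 'd) set"
    and \<omega> p :: "nat \<Rightarrow> real"
    and m s t i j r :: nat
    and x\<^sub>s x\<^sub>t a b c :: "real ^ 'd"
    and \<gamma> :: "nat list"
    and y :: "nat \<Rightarrow> real ^ 'd"
    and F\<^sub>b :: "(real ^ 'd) set"
  assumes subdivision: "polytopal_subdivision m P"
    and weights: "\<And>l. l \<in> {1..m} \<Longrightarrow> 0 < \<omega> l"
    and exponents: "\<And>l. l \<in> {1..m} \<Longrightarrow> 1 < p l"
    and endpoints: "s \<in> {1..m}" "t \<in> {1..m}" "s \<noteq> t" "x\<^sub>s \<in> P s" "x\<^sub>t \<in> P t"
    and path: "\<gamma> \<in> simple_cell_paths m P s t"
    and geodesic: "geodesic_gates P \<omega> p x\<^sub>s x\<^sub>t \<gamma> y"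
    and cells: "r + 1 < length \<gamma>" "i = \<gamma> ! r" "j = \<gamma> ! (r + 1)"
    and consecutive: "a = breaking_points x\<^sub>s x\<^sub>t \<gamma> y ! r"
      "b = breaking_points x\<^sub>s x\<^sub>t \<gamma> y ! (r + 1)"
      "c = breaking_points x\<^sub>s x\<^sub>t \<gamma> y ! (r + 2)"
    and positions: "a \<in> P i - common_face P i j" "b \<in> common_face P i j"
      "c \<in> P j - common_face P i j"
    and face: "F\<^sub>b face_of common_face P i j" "b \<in> rel_interior F\<^sub>b"
  shows "\<forall>v \<in> direction_space (affine hull F\<^sub>b). v \<noteq> 0 \<longrightarrow>
    \<omega> i * lp_norm (p i) v * cos (lp_angle (conj_exponent (p i)) (polar (p i) (b - a)) v) =
    \<omega> j * lp_norm (p j) v * cos (lp_angle (conj_exponent (p j)) (polar (p j) (c - b)) v) \<and>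
    \<omega> i * lp_norm (p i) v * cos (lp_angle (p i) v (polar (p i) (b - a))) =
    \<omega> j * lp_norm (p j) v * cos (lp_angle (p j) v (polar (p j) (c - b)))"
proof (intro ballI impI)
  fix v assume v: "v \<in> direction_space (affine hull F\<^sub>b)" and v0: "v \<noteq> 0"
  have "set \<gamma> \<subseteq> {1..m}"
    using path by (simp add: simple_cell_paths_def)
  moreover have "i \<in> set \<gamma>" "j \<in> set \<gamma>"
    using cells by auto
  ultimately have "i \<in> {1..m}" "j \<in> {1..m}"
    by blast+
  then have pi: "1 < p i" and pj: "1 < p j"
    using exponents by auto
  \<comment> \<open>\<open>b\<close> lies in the common face while \<open>a\<close> and
    \<open>c\<close> do not; both norms are therefore taken at a nonzero vector, where they are
    differentiable.\<close>
  have ba: "b - a \<noteq> 0" and cb: "b - c \<noteq> 0"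
    using positions by auto
  obtain \<delta> where \<delta>: "0 < \<delta>" "\<And>h. \<bar>h\<bar> < \<delta> \<Longrightarrow> b + h *\<^sub>R v \<in> F\<^sub>b"
    using rel_interior_perturb[OF face(2) v] by blast
  obtain K where K: "\<And>z. gate_cost \<omega> p x\<^sub>s x\<^sub>t \<gamma> (y(r := z)) =
      K + \<omega> i * lp_norm (p i) (z - a) + \<omega> j * lp_norm (p j) (c - z)"
    using gate_cost_fun_upd[OF cells(1)] unfolding cells(2,3) consecutive(1,3) by blast
  \<comment> \<open>The second norm is written with \<open>b - c\<close> instead of
    \<open>c - b\<close>, so that \<open>h\<close> enters both terms with the same sign.\<close>
  define g where "g h = \<omega> i * lp_norm (p i) (b - a + h *\<^sub>R v) + \<omega> j * lp_norm (p j) (b - c + h *\<^sub>R v)"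
    for h
  have cost: "gate_cost \<omega> p x\<^sub>s x\<^sub>t \<gamma> (y(r := b + h *\<^sub>R v)) = K + g h" for h
    using lp_norm_uminus[of "p j" "c - (b + h *\<^sub>R v)"] by (simp add: K g_def algebra_simps)
  have y: "y(r := b) = y"
    using breaking_points_nth_Suc[OF cells(1), of x\<^sub>s x\<^sub>t y] consecutive(2)
    by (intro fun_upd_idem) simp
  have "g 0 \<le> g h" if h: "\<bar>h\<bar> < \<delta>" for h
  proof -
    have "b + h *\<^sub>R v \<in> common_face P i j"
      using \<delta>(2)[OF h] face_of_imp_subset[OF face(1)] by blast
    \<comment> \<open>The new gates are again admissible: only entry \<open>r\<close>, which is at
      most \<open>length \<gamma> - 2\<close>, changes, so the function stays
      \<open>undefined\<close> outside the index range.\<close>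
    then have "y(r := b + h *\<^sub>R v) \<in> (\<Pi>\<^sub>E l\<in>{0..length \<gamma> - 2}. common_face P (\<gamma> ! l) (\<gamma> ! (l + 1)))"
      using geodesic cells
      by (auto simp: geodesic_gates_def is_arg_min_def PiE_iff extensional_def)
    then have "gate_cost \<omega> p x\<^sub>s x\<^sub>t \<gamma> y \<le> gate_cost \<omega> p x\<^sub>s x\<^sub>t \<gamma> (y(r := b + h *\<^sub>R v))"
      using geodesic by (auto simp: geodesic_gates_def is_arg_min_def not_less)
    then show ?thesis
      using cost[of 0] cost[of h] y by simp
  qed
  moreover have "(g has_field_derivative
      \<omega> i * (polar (p i) (b - a) \<bullet> v / lp_norm (p i) (b - a)) +
      \<omega> j * (polar (p j) (b - c) \<bullet> v / lp_norm (p j) (b - c))) (at 0)"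
    unfolding g_def
    by (intro DERIV_add DERIV_cmult lp_norm_has_field_derivative pi pj ba cb)
  ultimately have "\<omega> i * (polar (p i) (b - a) \<bullet> v / lp_norm (p i) (b - a)) +
      \<omega> j * (polar (p j) (b - c) \<bullet> v / lp_norm (p j) (b - c)) = 0"
    using \<delta>(1) by (intro DERIV_local_min[of g _ 0 \<delta>]) auto
  \<comment> \<open>Turning \<open>b - c\<close> back into \<open>c - b\<close> flips the sign of
    the second term, which makes the vanishing sum an equality of two terms.\<close>
  moreover have "polar (p j) (b - c) = - polar (p j) (c - b)"
    using polar_uminus[of "p j" "c - b"] by simp
  moreover have "lp_norm (p j) (b - c) = lp_norm (p j) (c - b)"
    using lp_norm_uminus[of "p j" "c - b"] by simp
  ultimately have eq: "\<omega> i * (polar (p i) (b - a) \<bullet> v / lp_norm (p i) (b - a)) =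
      \<omega> j * (polar (p j) (c - b) \<bullet> v / lp_norm (p j) (c - b))"
    by simp
  then show "\<omega> i * lp_norm (p i) v * cos (lp_angle (conj_exponent (p i)) (polar (p i) (b - a)) v) =
      \<omega> j * lp_norm (p j) v * cos (lp_angle (conj_exponent (p j)) (polar (p j) (c - b)) v) \<and>
      \<omega> i * lp_norm (p i) v * cos (lp_angle (p i) v (polar (p i) (b - a))) =
      \<omega> j * lp_norm (p j) v * cos (lp_angle (p j) v (polar (p j) (c - b)))"
    unfolding mult.assoc cos_lp_angle_polar[OF pi v0] cos_lp_angle_polar[OF pj v0] by simp
qed

end
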